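(* Let $n,p$ be positive integers, let $A$ be a real $n\times p$ matrix and $y\in\mathbb{R}^n$. Define $F:\mathbb{R}^p\to\mathbb{R}$ by $F(x)=\|x\|_1+\frac{\|Ax-y\|^2}{2}$. For $\beta>0$ let $X_\beta$ be a random vector in $\mathbb{R}^p$ whose probability density function is $\frac{1}{Z_\beta}\exp(-2\beta F(x))$, where $Z_\beta=\int_{\mathbb{R}^p}\exp(-2\beta F(x))\,dx$. For $x\in\mathbb{R}^p$ let $\pi(x)$ be the point of the set $\arg\min_{\mathbb{R}^p}F$ closest to $x$ in Euclidean norm. Then the random nonnegative number $\|X_\beta-\pi(X_\beta)\|$ converges to $0$ in probability as $\beta\to+\infty$; that is, for every $\delta>0$, $\mathbb{P}(\|X_\beta-\pi(X_\beta)\|\ge\delta)\to 0$ as $\beta\to+\infty$.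
   Context: $\|\cdot\|$ denotes the Euclidean norm and $\|x\|_1=\sum_{i=1}^p|x_i|$. A minimizer of $F$ over $\mathbb{R}^p$ is called a Lasso estimator; the set of Lasso estimators $\arg\min_{\mathbb{R}^p}F$ is known to be nonempty, convex and compact, so that $\pi(x)=\arg\min\{\|x-z\|: z\in\arg\min_{\mathbb{R}^p} F\}$ is well defined and single-valued. *)

theory Defs
  imports "HOL-Probability.Probability"
begin

definition l1_norm :: "real ^ 'p \<Rightarrow> real" where
  "l1_norm x = (\<Sum>i\<in>UNIV. \<bar>x $ i\<bar>)"

definition lasso_objective :: "real ^ 'p ^ 'n \<Rightarrow> real ^ 'n \<Rightarrow> real ^ 'p \<Rightarrow> real" where
  "lasso_objective A y x = l1_norm x + (norm (A *v x - y))\<^sup>2 / 2"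

definition lasso_estimators :: "real ^ 'p ^ 'n \<Rightarrow> real ^ 'n \<Rightarrow> (real ^ 'p) set" where
  "lasso_estimators A y = {x. is_arg_min (lasso_objective A y) (\<lambda>_. True) x}"

definition lasso_proj :: "real ^ 'p ^ 'n \<Rightarrow> real ^ 'n \<Rightarrow> real ^ 'p \<Rightarrow> real ^ 'p" where
  "lasso_proj A y x = closest_point (lasso_estimators A y) x"

definition gibbs_normalizer :: "real ^ 'p ^ 'n \<Rightarrow> real ^ 'n \<Rightarrow> real \<Rightarrow> real" where
  "gibbs_normalizer A y \<beta> = (LINT x|lborel. exp (- 2 * \<beta> * lasso_objective A y x))"

definition gibbs_density :: "real ^ 'p ^ 'n \<Rightarrow> real ^ 'n \<Rightarrow> real \<Rightarrow> real ^ 'p \<Rightarrow> real" where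
  "gibbs_density A y \<beta> x =
     1 / gibbs_normalizer A y \<beta> * exp (- 2 * \<beta> * lasso_objective A y x)"

end

theory Submission
  imports Defs
begin

text \<open>
  The objective dominates the Euclidean norm, so its sublevel sets are compact; hence it stays above
  its minimum by a fixed gap on the closed set of points at distance at least \<open>\<delta>\<close> from the minimizers.
  The Gibbs mass of that set decays exponentially relative to the mass of a small ball around one
  minimizer. Measurability holds because \<open>\<parallel>x - \<pi>(x)\<parallel>\<close> is the distance of \<open>x\<close> to the closed set
  of minimizers, which is continuous in \<open>x\<close>.
\<close>

lemma lasso_objective_continuous: "continuous_on S (lasso_objective A y)"
proof -
  have "linear ((*v) A)" by simp
  then have "continuous_on S ((*v) A)"
    by (rule linear_continuous_on[OF linear_conv_bounded_linear[THEN iffD1]])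
  then show ?thesis
    unfolding lasso_objective_def l1_norm_def by (intro continuous_intros) auto
qed

text \<open>The l1 norm dominates the Euclidean norm and the quadratic term is nonnegative. This is
  the coercivity behind every existence argument below.\<close>

lemma norm_le_lasso_objective: "norm x \<le> lasso_objective A y x"
  using norm_le_l1_cart[of x] unfolding lasso_objective_def l1_norm_def
  by (smt (verit) divide_nonneg_nonneg zero_le_power2)

text \<open>Fix \<open>k\<close> in \<open>K\<close>. Points of \<open>K\<close> outside the ball of
  radius \<open>f k\<close> have values above \<open>f k\<close>, so a minimizer over the compact
  part of \<open>K\<close> inside that ball is a minimizer over all of \<open>K\<close>. It is
  applied both to the whole space and to the points far from the estimators.\<close>

lemma continuous_coercive_attains_inf:
  fixes f :: "'a::euclidean_space \<Rightarrow> real"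
  assumes cont: "continuous_on UNIV f" and coercive: "\<And>x. norm x \<le> f x"
    and "closed K" "K \<noteq> {}"
  obtains x where "x \<in> K" "\<And>z. z \<in> K \<Longrightarrow> f x \<le> f z"
proof -
  obtain k where k: "k \<in> K" using \<open>K \<noteq> {}\<close> by blast
  let ?S = "K \<inter> cball 0 (f k)"
  have "compact ?S" by (simp add: \<open>closed K\<close> closed_Int_compact)
  moreover have "k \<in> ?S" using k coercive by simp
  moreover have "continuous_on ?S f" using cont continuous_on_subset by blast
  ultimately obtain x where x: "x \<in> ?S" "\<forall>z\<in>?S. f x \<le> f z"
    using continuous_attains_inf[of ?S f] by blast
  have "f x \<le> f z" if "z \<in> K" for z
  proof (cases "z \<in> ?S")
    case False
    then have "f k < f z" using that coercive[of z] by simp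
    moreover have "f x \<le> f k" using x(2) \<open>k \<in> ?S\<close> by blast
    ultimately show ?thesis by linarith
  qed (use x in blast)
  with x show ?thesis using that by blast
qed

lemma lasso_estimators_iff: "x \<in> lasso_estimators A y \<longleftrightarrow> (\<forall>z. lasso_objective A y x \<le> lasso_objective A y z)"
  by (auto simp: lasso_estimators_def is_arg_min_linorder)

lemma lasso_estimators_nonempty: "lasso_estimators A y \<noteq> {}"
  using continuous_coercive_attains_inf[OF lasso_objective_continuous norm_le_lasso_objective closed_UNIV]
  by (metis UNIV_I UNIV_not_empty empty_iff lasso_estimators_iff)

lemma lasso_estimators_closed: "closed (lasso_estimators A y)"
proof -
  have "lasso_estimators A y = (\<Inter>z. {x. lasso_objective A y x \<le> lasso_objective A y z})"
    by (auto simp: lasso_estimators_iff)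
  then show ?thesis
    by (auto intro!: closed_INT closed_Collect_le lasso_objective_continuous)
qed

text \<open>A nearest point realises the distance to the set. Hence the projection can be traded for
  \<open>setdist\<close>, whose continuity in \<open>x\<close> is immediate.\<close>

lemma norm_minus_lasso_proj: "norm (x - lasso_proj A y x) = setdist {x} (lasso_estimators A y)"
  unfolding lasso_proj_def dist_norm[symmetric]
  by (rule setdist_closest_point[OF lasso_estimators_closed lasso_estimators_nonempty, symmetric])

text \<open>The objective attains its minimum over the far set, at a point that is not an estimator.
  That minimal value serves as \<open>b\<close>.\<close>

lemma lasso_objective_gap:
  assumes "\<delta> > 0"
  obtains b where "\<And>x. x \<in> lasso_estimators A y \<Longrightarrow> lasso_objective A y x < b"
    "\<And>x. setdist {x} (lasso_estimators A y) \<ge> \<delta> \<Longrightarrow> b \<le> lasso_objective A y x"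
proof (cases "{x. setdist {x} (lasso_estimators A y) \<ge> \<delta>} = {}")
  case True
  obtain e where "e \<in> lasso_estimators A y" using lasso_estimators_nonempty by blast
  then show thesis
    \<comment> \<open>With no far points the second property is vacuous, so any level above the
      global minimum will do.\<close>
    using that[of "lasso_objective A y e + 1"] True
    by (smt (verit) empty_Collect_eq lasso_estimators_iff)
next
  case False
  let ?K = "{x. setdist {x} (lasso_estimators A y) \<ge> \<delta>}"
  have "closed ?K" by (intro closed_Collect_le continuous_intros continuous_on_setdist)
  then obtain k where k: "k \<in> ?K" "\<And>z. z \<in> ?K \<Longrightarrow> lasso_objective A y k \<le> lasso_objective A y z"
    using continuous_coercive_attains_inf[OF lasso_objective_continuous norm_le_lasso_objective _ False]
    by metis
  have "k \<notin> lasso_estimators A y"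
    using k(1) \<open>\<delta> > 0\<close> by (auto simp: setdist_sing_in_set)
  then have "lasso_objective A y x < lasso_objective A y k" if "x \<in> lasso_estimators A y" for x
    using that by (meson lasso_estimators_iff linorder_not_less order_trans)
  then show thesis using that k(2) by blast
qed

text \<open>Laplace-type estimate: up to constant factors, the numerator is at most
  \<open>exp (- 2 * \<beta> * b)\<close> and the denominator at least
  \<open>exp (- 2 * \<beta> * c)\<close> for some \<open>c < b\<close>.\<close>

lemma gibbs_mass_tendsto_0:
  fixes f :: "'a::euclidean_space \<Rightarrow> real"
  assumes cont: "continuous_on UNIV f" and K: "K \<in> sets lborel"
    and gap: "f e < b" "\<And>x. x \<in> K \<Longrightarrow> b \<le> f x"
    and int: "\<And>\<beta>. \<beta> > 0 \<Longrightarrow> integrable lborel (\<lambda>x. exp (- 2 * \<beta> * f x))"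
  shows "((\<lambda>\<beta>. (LINT x|lborel. exp (- 2 * \<beta> * f x) * indicator K x)
            / (LINT x|lborel. exp (- 2 * \<beta> * f x))) \<longlongrightarrow> 0) at_top"
proof -
  \<comment> \<open>The intermediate level does two jobs: \<open>f e < c\<close> leaves room for a
    ball around \<open>e\<close> on which \<open>f < c\<close>, and \<open>c < b\<close> gives the
    decay rate \<open>2 * (b - c)\<close>.\<close>
  obtain c where c: "f e < c" "c < b" using dense[OF gap(1)] by blast
  have "open {x. f x < c}" by (intro open_Collect_less cont continuous_on_const)
  then obtain r where r: "r > 0" "ball e r \<subseteq> {x. f x < c}"
    using c(1) by (metis mem_Collect_eq open_contains_ball)
  define v where "v = measure lborel (ball e r)"
  have fin: "emeasure lborel (ball e r) < \<infinity>"
    by (rule emeasure_bounded_finite) simp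
  have v: "v > 0" unfolding v_def using r(1) content_ball_pos by simp
  \<comment> \<open>\<open>K\<close> may have infinite volume, so a constant bound on the integrand
    is not enough there. One factor \<open>exp (- 2 * f x)\<close> is kept for integrability, and
    only the remaining power \<open>\<beta> - 1\<close> is bounded through the gap.\<close>
  define I where "I = (LINT x|lborel. exp (- 2 * f x))"
  have I: "integrable lborel (\<lambda>x. exp (- 2 * f x))" using int[of 1] by simp
  have den: "v * exp (- 2 * \<beta> * c) \<le> (LINT x|lborel. exp (- 2 * \<beta> * f x))" if "\<beta> > 0" for \<beta>
  proof -
    have "v * exp (- 2 * \<beta> * c) = (LINT x|lborel. indicator (ball e r) x * exp (- 2 * \<beta> * c))"
      using fin by (simp add: v_def)
    also have "\<dots> \<le> (LINT x|lborel. exp (- 2 * \<beta> * f x))"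
    proof (rule integral_mono[OF _ int[OF that]])
      show "integrable lborel (\<lambda>x. indicator (ball e r) x * exp (- 2 * \<beta> * c))"
        using fin by (intro integrable_mult_left integrable_real_indicator) auto
      show "indicator (ball e r) x * exp (- 2 * \<beta> * c) \<le> exp (- 2 * \<beta> * f x)" for x
        using r(2) that by (auto simp: indicator_def subset_iff less_imp_le)
    qed
    finally show ?thesis .
  qed
  have num: "(LINT x|lborel. exp (- 2 * \<beta> * f x) * indicator K x) \<le> exp (- 2 * (\<beta> - 1) * b) * I"
    if "\<beta> \<ge> 1" for \<beta>
  proof -
    have "(LINT x|lborel. exp (- 2 * \<beta> * f x) * indicator K x)
        \<le> (LINT x|lborel. exp (- 2 * (\<beta> - 1) * b) * exp (- 2 * f x))"
    proof (rule integral_mono)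
      show "integrable lborel (\<lambda>x. exp (- 2 * \<beta> * f x) * indicator K x)"
        using integrable_real_mult_indicator[OF K int] that by (simp add: mult.commute)
      show "integrable lborel (\<lambda>x. exp (- 2 * (\<beta> - 1) * b) * exp (- 2 * f x))"
        using I by simp
      fix x
      have "x \<in> K \<Longrightarrow> (\<beta> - 1) * b \<le> (\<beta> - 1) * f x"
        using that gap(2) by (intro mult_left_mono) auto
      then show "exp (- 2 * \<beta> * f x) * indicator K x \<le> exp (- 2 * (\<beta> - 1) * b) * exp (- 2 * f x)"
        by (auto simp: indicator_def exp_add[symmetric] algebra_simps)
    qed
    then show ?thesis by (simp add: I_def)
  qed
  have bound: "((\<lambda>\<beta>. (exp (- 2 * (\<beta> - 1) * b) * I) / (v * exp (- 2 * \<beta> * c))) \<longlongrightarrow> 0) at_top"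
  proof -
    have "filterlim (\<lambda>\<beta>. (2 * (b - c)) * \<beta>) at_top at_top"
      using c(2) by (intro filterlim_tendsto_pos_mult_at_top[OF tendsto_const _ filterlim_ident]) simp
    then have "((\<lambda>\<beta>. exp (- ((2 * (b - c)) * \<beta>))) \<longlongrightarrow> 0) at_top"
      by (intro filterlim_compose[OF exp_at_bot] filterlim_compose[OF filterlim_uminus_at_bot_at_top])
    \<comment> \<open>The constant \<open>exp (2 * b)\<close> accounts for the exponent
      \<open>\<beta> - 1\<close> in the numerator bound.\<close>
    then have "((\<lambda>\<beta>. exp (2 * b) * I / v * exp (- ((2 * (b - c)) * \<beta>))) \<longlongrightarrow> 0) at_top"
      by (rule tendsto_mult_right_zero)
    moreover have "exp (2 * b) * I / v * exp (- ((2 * (b - c)) * \<beta>))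
        = (exp (- 2 * (\<beta> - 1) * b) * I) / (v * exp (- 2 * \<beta> * c))" for \<beta>
    proof -
      have "exp (2 * b) * exp (- ((2 * (b - c)) * \<beta>)) * exp (- 2 * \<beta> * c) = exp (- 2 * (\<beta> - 1) * b)"
        by (simp add: exp_add[symmetric] algebra_simps)
      then show ?thesis using v by (simp add: divide_simps mult_ac)
    qed
    ultimately show ?thesis by simp
  qed
  show ?thesis
  proof (rule tendsto_sandwich[OF _ _ tendsto_const bound])
    show "\<forall>\<^sub>F \<beta> in at_top. 0 \<le> (LINT x|lborel. exp (- 2 * \<beta> * f x) * indicator K x)
            / (LINT x|lborel. exp (- 2 * \<beta> * f x))"
      by (intro always_eventually allI divide_nonneg_nonneg Bochner_Integration.integral_nonneg) auto
    show "\<forall>\<^sub>F \<beta> in at_top. (LINT x|lborel. exp (- 2 * \<beta> * f x) * indicator K x)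
            / (LINT x|lborel. exp (- 2 * \<beta> * f x))
          \<le> (exp (- 2 * (\<beta> - 1) * b) * I) / (v * exp (- 2 * \<beta> * c))"
      using eventually_ge_at_top[of 1]
    proof eventually_elim
      case (elim \<beta>)
      have "0 \<le> I" unfolding I_def by (intro Bochner_Integration.integral_nonneg) auto
      then show ?case
        using num[OF elim] den[of \<beta>] elim v by (intro frac_le) auto
    qed
  qed
qed

text \<open>Bochner integrals of non-integrable functions are \<open>0\<close>, so a zero normalizer would give the
  zero density, which is not the density of a probability measure.\<close>

lemma gibbs_integrable_if_distributed:
  assumes "prob_space M" and D: "distributed M lborel X (\<lambda>x. ennreal (gibbs_density A y \<beta> x))"
  shows "integrable lborel (\<lambda>x. exp (- 2 * \<beta> * lasso_objective A y x))"
proof (rule ccontr)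
  interpret prob_space M by fact
  assume "\<not> ?thesis"
  then have "gibbs_normalizer A y \<beta> = 0"
    unfolding gibbs_normalizer_def by (rule not_integrable_integral_eq)
  then have "emeasure M (X -` UNIV \<inter> space M) = 0"
    using distributed_emeasure[OF D, of UNIV] by (simp add: gibbs_density_def)
  then show False using emeasure_space_1 by simp
qed

lemma gibbs_prob_eq:
  assumes "prob_space M" and D: "distributed M lborel X (\<lambda>x. ennreal (gibbs_density A y \<beta> x))"
    and K: "K \<in> sets lborel"
  shows "measure M (X -` K \<inter> space M) =
    (LINT x|lborel. exp (- 2 * \<beta> * lasso_objective A y x) * indicator K x)
      / (LINT x|lborel. exp (- 2 * \<beta> * lasso_objective A y x))"
proof -
  \<comment> \<open>\<open>ennreal\<close> sends negative reals to 0. Nonnegativity of the density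
    makes the passage between the extended and the Bochner integral lossless.\<close>
  have Z: "gibbs_normalizer A y \<beta> \<ge> 0"
    unfolding gibbs_normalizer_def by (intro Bochner_Integration.integral_nonneg) auto
  have int: "integrable lborel (\<lambda>x. gibbs_density A y \<beta> x * indicator K x)"
    unfolding gibbs_density_def
    using integrable_real_mult_indicator[OF K gibbs_integrable_if_distributed[OF assms(1,2)]]
    by (simp add: mult_ac)
  have "emeasure M (X -` K \<inter> space M) = (\<integral>\<^sup>+x. ennreal (gibbs_density A y \<beta> x * indicator K x) \<partial>lborel)"
    unfolding distributed_emeasure[OF D K]
    by (intro nn_integral_cong) (auto simp: indicator_def)
  also have "\<dots> = ennreal (LINT x|lborel. gibbs_density A y \<beta> x * indicator K x)"
    using Z by (intro nn_integral_eq_integral[OF int]) (auto simp: gibbs_density_def)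
  finally have "measure M (X -` K \<inter> space M) = (LINT x|lborel. gibbs_density A y \<beta> x * indicator K x)"
    using Z by (intro measure_eq_emeasure_eq_ennreal Bochner_Integration.integral_nonneg) (auto simp: gibbs_density_def)
  then show ?thesis by (simp add: gibbs_density_def gibbs_normalizer_def mult.assoc)
qed

theorem mainTheorem1:
  fixes A :: "real ^ 'p ^ 'n" and y :: "real ^ 'n"
    and M :: "real \<Rightarrow> 'a measure" and X :: "real \<Rightarrow> 'a \<Rightarrow> real ^ 'p"
  assumes "\<And>\<beta>. \<beta> > 0 \<Longrightarrow> prob_space (M \<beta>)"
    and "\<And>\<beta>. \<beta> > 0 \<Longrightarrow> distributed (M \<beta>) lborel (X \<beta>) (\<lambda>x. ennreal (gibbs_density A y \<beta> x))"
  shows "(\<forall>\<beta>>0. (\<lambda>\<omega>. norm (X \<beta> \<omega> - lasso_proj A y (X \<beta> \<omega>))) \<in> borel_measurable (M \<beta>)) \<and>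
    (\<forall>\<delta>>0. ((\<lambda>\<beta>. measure (M \<beta>)
        {\<omega> \<in> space (M \<beta>). norm (X \<beta> \<omega> - lasso_proj A y (X \<beta> \<omega>)) \<ge> \<delta>}) \<longlongrightarrow> 0) at_top)"
proof (intro conjI allI impI)
  let ?d = "\<lambda>x. setdist {x} (lasso_estimators A y)"
  have cont: "continuous_on UNIV ?d" by (rule continuous_on_setdist)
  fix \<beta> :: real assume "\<beta> > 0"
  then have "X \<beta> \<in> borel_measurable (M \<beta>)"
    using distributed_measurable[OF assms(2)] by simp
  then have "(\<lambda>\<omega>. ?d (X \<beta> \<omega>)) \<in> borel_measurable (M \<beta>)"
    using borel_measurable_continuous_onI[OF cont] by (rule measurable_compose)
  then show "(\<lambda>\<omega>. norm (X \<beta> \<omega> - lasso_proj A y (X \<beta> \<omega>))) \<in> borel_measurable (M \<beta>)"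
    by (simp add: norm_minus_lasso_proj)
next
  fix \<delta> :: real assume "\<delta> > 0"
  let ?K = "{x. \<delta> \<le> setdist {x} (lasso_estimators A y)}"
  have "closed ?K" by (intro closed_Collect_le continuous_intros continuous_on_setdist)
  then have K: "?K \<in> sets lborel" by simp
  obtain b where b: "\<And>x. x \<in> lasso_estimators A y \<Longrightarrow> lasso_objective A y x < b"
    "\<And>x. \<delta> \<le> setdist {x} (lasso_estimators A y) \<Longrightarrow> b \<le> lasso_objective A y x"
    using lasso_objective_gap[OF \<open>\<delta> > 0\<close>] by blast
  obtain e where e: "e \<in> lasso_estimators A y" using lasso_estimators_nonempty by blast
  have "((\<lambda>\<beta>. (LINT x|lborel. exp (- 2 * \<beta> * lasso_objective A y x) * indicator ?K x)
      / (LINT x|lborel. exp (- 2 * \<beta> * lasso_objective A y x))) \<longlongrightarrow> 0) at_top"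
    using b by (intro gibbs_mass_tendsto_0[OF lasso_objective_continuous K b(1)[OF e]]
        gibbs_integrable_if_distributed[OF assms]) auto
  then show "((\<lambda>\<beta>. measure (M \<beta>)
      {\<omega> \<in> space (M \<beta>). norm (X \<beta> \<omega> - lasso_proj A y (X \<beta> \<omega>)) \<ge> \<delta>}) \<longlongrightarrow> 0) at_top"
  proof (rule Lim_transform_eventually)
    show "\<forall>\<^sub>F \<beta> in at_top. (LINT x|lborel. exp (- 2 * \<beta> * lasso_objective A y x) * indicator ?K x)
        / (LINT x|lborel. exp (- 2 * \<beta> * lasso_objective A y x)) =
      measure (M \<beta>) {\<omega> \<in> space (M \<beta>). norm (X \<beta> \<omega> - lasso_proj A y (X \<beta> \<omega>)) \<ge> \<delta>}"
      \<comment> \<open>The law of \<open>X \<beta>\<close> is prescribed only for positive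
        \<open>\<beta>\<close>, so the two functions are identified only eventually.\<close>
      using eventually_gt_at_top[of 0]
    proof eventually_elim
      case (elim \<beta>)
      have "{\<omega> \<in> space (M \<beta>). norm (X \<beta> \<omega> - lasso_proj A y (X \<beta> \<omega>)) \<ge> \<delta>} = X \<beta> -` ?K \<inter> space (M \<beta>)"
        by (auto simp: norm_minus_lasso_proj)
      then show ?case using gibbs_prob_eq[OF assms K, OF elim elim] by simp
    qed
  qed
qed

end
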